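(* The space $S=\mathcal{S}^2/\!\sim_{sym}$, endowed with the quotient topology, is homeomorphic to the subspace $P$ of $\mathbb{R}^4$.
   Context: $\mathcal{S}^2=\{(x,y,z)\in\mathbb{R}^3: x^2+y^2+z^2=1\}$ is the unit sphere, and $\sim_{sym}$ is the antipodal relation on it: $a\sim_{sym}a'$ if and only if $a'=\pm a$. The map $p:\mathcal{S}^2\to\mathbb{R}^4$ is defined by $p(x,y,z)=(xy,\ xz,\ y^2-z^2,\ 2yz)$, and $P=p(\mathcal{S}^2)\subset\mathbb{R}^4$ is its image, with the subspace topology. *)

theory Defs
  imports "HOL-Analysis.Analysis"
begin

text \<open>For an equivalence relation \<open>r\<close> on \<open>topspace X\<close>, this is the finest topology on the set
  of classes making the canonical projection \<open>\<lambda>x. r `` {x}\<close> continuous.\<close>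

definition quotient_topology :: "'a topology \<Rightarrow> ('a \<times> 'a) set \<Rightarrow> 'a set topology" where
  "quotient_topology X r =
     topology (\<lambda>U. U \<subseteq> topspace X // r \<and> openin X {x \<in> topspace X. r `` {x} \<in> U})"

lemma openin_quotient_topology:
  "openin (quotient_topology X r) U \<longleftrightarrow>
     U \<subseteq> topspace X // r \<and> openin X {x \<in> topspace X. r `` {x} \<in> U}"
proof -
  let ?P = "\<lambda>U. U \<subseteq> topspace X // r \<and> openin X {x \<in> topspace X. r `` {x} \<in> U}"
  have "?P (S \<inter> T)" if "?P S" "?P T" for S T
  proof -
    have "{x \<in> topspace X. r `` {x} \<in> S \<inter> T} =
        {x \<in> topspace X. r `` {x} \<in> S} \<inter> {x \<in> topspace X. r `` {x} \<in> T}"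
      by blast
    then show ?thesis
      using that openin_Int by (metis (no_types, lifting) le_infI1)
  qed
  moreover have "?P (\<Union>K)" if "\<forall>S\<in>K. ?P S" for K
  proof -
    have "{x \<in> topspace X. r `` {x} \<in> \<Union>K} = (\<Union>S\<in>K. {x \<in> topspace X. r `` {x} \<in> S})"
      by blast
    moreover have "openin X (\<Union>S\<in>K. {x \<in> topspace X. r `` {x} \<in> S})"
      using that by blast
    ultimately have "openin X {x \<in> topspace X. r `` {x} \<in> \<Union>K}"
      by argo
    moreover have "\<Union>K \<subseteq> topspace X // r"
      using that by blast
    ultimately show ?thesis
      by blast
  qed
  ultimately have "istopology ?P"
    unfolding istopology_def by blast
  then show ?thesis
    unfolding quotient_topology_def by simp
qed

lemma topspace_quotient_topology [simp]: "topspace (quotient_topology X r) = topspace X // r"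
proof -
  have "{x \<in> topspace X. r `` {x} \<in> topspace X // r} = topspace X"
    by (auto intro: quotientI)
  then have "openin (quotient_topology X r) (topspace X // r)"
    by (simp add: openin_quotient_topology)
  then show ?thesis
    by (meson openin_quotient_topology openin_subset openin_topspace subset_antisym)
qed

lemma quotient_map_quotient_topology:
  "quotient_map X (quotient_topology X r) (\<lambda>x. r `` {x})"
  by (auto simp: quotient_map_def openin_quotient_topology quotient_def)

definition unit_sphere :: "(real^3) set" where
  "unit_sphere = {v. (v$1)\<^sup>2 + (v$2)\<^sup>2 + (v$3)\<^sup>2 = 1}"

lemma unit_sphere_eq: "unit_sphere = sphere 0 1"
  by (auto simp: unit_sphere_def norm_vec_def L2_set_def sum_3)

definition antipodal :: "((real^3) \<times> (real^3)) set" where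
  "antipodal = {(a, a'). a \<in> unit_sphere \<and> a' \<in> unit_sphere \<and> (a' = a \<or> a' = - a)}"

lemma equiv_antipodal: "equiv unit_sphere antipodal"
  by (auto simp: equiv_def refl_on_def sym_def trans_def antipodal_def)

definition p_map :: "real^3 \<Rightarrow> real^4" where
  "p_map v = (let x = v$1; y = v$2; z = v$3 in vector [x * y, x * z, y\<^sup>2 - z\<^sup>2, 2 * y * z])"

lemma p_map_nth [simp]:
  "p_map v $ 1 = v$1 * v$2"
  "p_map v $ 2 = v$1 * v$3"
  "p_map v $ 3 = (v$2)\<^sup>2 - (v$3)\<^sup>2"
  "p_map v $ 4 = 2 * v$2 * v$3"
  by (simp_all add: p_map_def vector_def Let_def)

definition P_space :: "(real^4) set" where
  "P_space = p_map ` unit_sphere"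

end

theory Submission
  imports Defs
begin

text \<open>
  Write a point of the sphere as \<open>(x, w)\<close> with \<open>w = y + i z\<close> complex. Then \<open>p\<close> records exactly the
  two complex numbers \<open>x w\<close> and \<open>w\<^sup>2\<close>, both of which are unchanged when \<open>(x, w)\<close> is replaced by
  \<open>(- x, - w)\<close>. Conversely \<open>w\<^sup>2\<close> determines \<open>w\<close> up to sign; if \<open>w \<noteq> 0\<close>, then \<open>x w\<close> determines \<open>x\<close>
  with the matching sign, and if \<open>w = 0\<close>, then \<open>x = 1\<close> or \<open>x = - 1\<close> because the point lies on the
  sphere. Hence the fibres of \<open>p\<close> are exactly the antipodal pairs (\<open>p_map_eq_iff\<close>).

  The sphere is compact and \<open>P\<close> is Hausdorff, so \<open>p\<close> is a closed map and therefore a quotient map onto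
  \<open>P\<close>. The canonical projection is a quotient map with the same fibres, and a quotient space is
  determined up to homeomorphism by the fibres of its quotient map
  (\<open>quotient_maps_same_fibres_homeomorphic\<close>).
\<close>

text \<open>The second map factors through the first. The factor is a quotient map because the composite is,
  and it is injective because the second map identifies no more points than the first; an
  injective quotient map is a homeomorphism.\<close>

lemma quotient_maps_same_fibres_homeomorphic:
  assumes f: "quotient_map X Y f" and h: "quotient_map X Z h"
    and fibres: "\<And>x x'. \<lbrakk>x \<in> topspace X; x' \<in> topspace X\<rbrakk> \<Longrightarrow> f x = f x' \<longleftrightarrow> h x = h x'"
  shows "Y homeomorphic_space Z"
proof -
  have "continuous_map X Z h"
    using h by (rule quotient_imp_continuous_map)
  then obtain g where g: "\<And>x. x \<in> topspace X \<Longrightarrow> g (f x) = h x"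
    using fibres by (metis quotient_map_lift_exists [OF f])
  have "quotient_map X Z (g \<circ> f)"
    using h by (rule quotient_map_eq) (simp add: g)
  then have "quotient_map Y Z g"
    using quotient_map_compose_eq [OF f] by blast
  moreover have "inj_on g (topspace Y)"
    unfolding quotient_imp_surjective_map [OF f, symmetric] by (auto simp: inj_on_def g fibres)
  ultimately show ?thesis
    by (meson homeomorphic_map_def homeomorphic_map_imp_homeomorphic_space)
qed

lemma antipodal_class_eq_iff:
  assumes "v \<in> unit_sphere" and "v' \<in> unit_sphere"
  shows "antipodal `` {v} = antipodal `` {v'} \<longleftrightarrow> v' = v \<or> v' = - v"
  using eq_equiv_class_iff [OF equiv_antipodal] assms by (auto simp: antipodal_def)

lemma p_map_eq_iff:
  assumes v: "v \<in> unit_sphere" and v': "v' \<in> unit_sphere"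
  shows "p_map v = p_map v' \<longleftrightarrow> v' = v \<or> v' = - v"
proof
  assume eq: "p_map v = p_map v'"
  define w where "w = Complex (v$2) (v$3)"
  define w' where "w' = Complex (v'$2) (v'$3)"
  have "p_map v $ i = p_map v' $ i" for i
    using eq by simp
  from this [of 1] this [of 2] this [of 3] this [of 4]
  have square: "w'\<^sup>2 = w\<^sup>2" and scaled: "of_real (v'$1) * w' = of_real (v$1) * w"
    by (simp_all add: w_def w'_def complex_eq_iff power2_eq_square mult.commute)
  from square have sign: "w' = w \<or> w' = - w"
    by (simp add: power2_eq_iff)
  have "(v'$1 = v$1 \<and> w' = w) \<or> (v'$1 = - v$1 \<and> w' = - w)"
  proof (cases "w = 0")
    case True
    then have "(v$1)\<^sup>2 = 1" "(v'$1)\<^sup>2 = 1"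
      using v v' sign by (auto simp: unit_sphere_def w_def w'_def complex_eq_iff)
    then show ?thesis
      using True sign by (auto simp: power2_eq_1_iff)
  next
    case False
    from sign show ?thesis
    proof
      assume "w' = w"
      then show ?thesis
        using scaled False by simp
    next
      assume "w' = - w"
      then have "of_real (- v'$1) * w = of_real (v$1) * w"
        using scaled by simp
      then have "- v'$1 = v$1"
        using False by (simp only: mult_cancel_right of_real_eq_iff) simp
      then show ?thesis
        using \<open>w' = - w\<close> by simp
    qed
  qed
  then show "v' = v \<or> v' = - v"
    by (auto simp: vec_eq_iff forall_3 w_def w'_def complex_eq_iff)
qed (auto simp: vec_eq_iff forall_4)

lemma continuous_on_p_map: "continuous_on S p_map"
proof -
  have "continuous_on S (\<lambda>v. p_map v $ i)" for i
    using exhaust_4 [of i] by (elim disjE; simp; intro continuous_intros)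
  then have "continuous_on S (\<lambda>v. \<chi> i. p_map v $ i)"
    by (rule continuous_on_vec_lambda)
  then show ?thesis
    by simp
qed

lemma quotient_map_p_map: "quotient_map (top_of_set unit_sphere) (top_of_set P_space) p_map"
proof (rule T1_Spaces.continuous_imp_quotient_map)
  show "continuous_map (top_of_set unit_sphere) (top_of_set P_space) p_map"
    by (auto simp: continuous_on_p_map P_space_def)
  show "compact_space (top_of_set unit_sphere)"
    by (simp add: compact_space_subtopology unit_sphere_eq)
  show "Hausdorff_space (top_of_set P_space)"
    by (simp add: Hausdorff_space_subtopology)
qed (simp add: P_space_def)

theorem mainTheorem3:
  shows "quotient_topology (top_of_set unit_sphere) antipodal homeomorphic_space top_of_set P_space"
  by (rule quotient_maps_same_fibres_homeomorphic [OF quotient_map_quotient_topology quotient_map_p_map])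
     (simp add: antipodal_class_eq_iff p_map_eq_iff)

end
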